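(* Let $E$ be a Dedekind complete vector lattice with the countable sup property and a strong order unit. Suppose that $E$ admits a (necessarily unique) Hausdorff uo-Lebesgue topology $\widehat\tau_E$. Let $F$ be a vector sublattice of $E$ that contains a strong order unit of $E$. Then $$\overline{F}^{\widehat\tau_E}=a_{\sigma\mathrm{o}}(F)=a_{\mathrm{o}}(F)=a_{\sigma\mathrm{uo}}(F)=a_{\mathrm{uo}}(F)$$ in $E$.
   Context: All vector lattices are real and Archimedean. $E$ has the countable sup property if every non-empty subset of $E$ that has a supremum contains an at most countable subset with the same supremum. A strong order unit of $E$ is an element $e$ such that for every $x\in E$ there is $\lambda\ge0$ with $|x|\le\lambda|e|$. In $E$, a net $(x_\alpha)_{\alpha\in A}$ is order convergent to $x$ ($x_\alpha\xrightarrow{\mathrm{o}}x$) if there is a net $(y_\beta)_{\beta\in B}$ in $E$ with $y_\beta\downarrow 0$ such that for every $\beta_0\in B$ there is $\alpha_0\in A$ with $|x-x_\alpha|\le y_{\beta_0}$ for all $\alpha\ge\alpha_0$; it is unbounded order convergent to $x$ ($x_\alpha\xrightarrow{\mathrm{uo}}x$) if $|x_\alpha-x|\wedge y\xrightarrow{\mathrm{o}}0$ for all $y\in E^+$. A uo-Lebesgue topology on $E$ is a locally solid linear topology $\tau$ on $E$ such that $x_\alpha\xrightarrow{\mathrm{uo}}0$ implies $x_\alpha\xrightarrow{\tau}0$ for every net; $E$ admits at most one Hausdorff one, denoted $\widehat\tau_E$. For $S\subseteq E$, $a_{\mathrm{o}}(S)$ (resp. $a_{\sigma\mathrm{o}}(S)$)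 is the set of all $x\in E$ for which there is a net (resp. a sequence) in $S$ that is order convergent to $x$ in $E$; $a_{\mathrm{uo}}(S)$ and $a_{\sigma\mathrm{uo}}(S)$ are defined likewise with unbounded order convergence. $\overline{S}^{\tau}$ is the closure of $S$ in the topology $\tau$. *)

theory Defs
  imports "HOL-Analysis.Analysis" "HOL-Library.Lattice_Algebras" "HOL-Library.Lub_Glb"
begin

class archimedean_vector_lattice = ordered_real_vector + lattice_ab_group_add_abs +
  assumes archimedean: "(\<And>n::nat. real n *\<^sub>R x \<le> y) \<Longrightarrow> x \<le> 0"

definition countable_sup_property :: "'a::order itself \<Rightarrow> bool" where
  "countable_sup_property _ \<longleftrightarrow>
     (\<forall>(S::'a set) s. S \<noteq> {} \<and> isLub UNIV S s \<longrightarrow> (\<exists>C\<subseteq>S. countable C \<and> isLub UNIV C s))"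

definition strong_order_unit :: "'a::archimedean_vector_lattice \<Rightarrow> bool" where
  "strong_order_unit e \<longleftrightarrow> (\<forall>x. \<exists>c\<ge>0. \<bar>x\<bar> \<le> c *\<^sub>R \<bar>e\<bar>)"

definition vector_sublattice :: "'a::archimedean_vector_lattice set \<Rightarrow> bool" where
  "vector_sublattice F \<longleftrightarrow> subspace F \<and> (\<forall>x\<in>F. \<forall>y\<in>F. sup x y \<in> F \<and> inf x y \<in> F)"

definition solid :: "'a::archimedean_vector_lattice set \<Rightarrow> bool" where
  "solid S \<longleftrightarrow> (\<forall>x y. y \<in> S \<and> \<bar>x\<bar> \<le> \<bar>y\<bar> \<longrightarrow> x \<in> S)"

text \<open>A net is a pair of a directed preorder \<open>r\<close>, whose index set is \<open>Field r\<close>, and a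
  function on the index type, of which only the values on \<open>Field r\<close> matter;
  \<open>(\<alpha>, \<beta>) \<in> r\<close> means \<open>\<alpha> \<le> \<beta>\<close>.\<close>

definition directed :: "'i rel \<Rightarrow> bool" where
  "directed r \<longleftrightarrow> Field r \<noteq> {} \<and> Preorder r \<and>
     (\<forall>a\<in>Field r. \<forall>b\<in>Field r. \<exists>c. (a, c) \<in> r \<and> (b, c) \<in> r)"

definition tails :: "'i rel \<Rightarrow> 'i filter" where
  "tails r = (INF a\<in>Field r. principal {b. (a, b) \<in> r})"

lemma eventually_tails:
  assumes "directed r"
  shows "eventually P (tails r) \<longleftrightarrow> (\<exists>a\<in>Field r. \<forall>b. (a, b) \<in> r \<longrightarrow> P b)"
proof -
  have tr: "trans r" and ne: "Field r \<noteq> {}" using assms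
    by (auto simp: directed_def preorder_on_def)
  have "eventually P (tails r) \<longleftrightarrow> (\<exists>a\<in>Field r. eventually P (principal {b. (a, b) \<in> r}))"
    unfolding tails_def
  proof (rule eventually_INF_base[OF ne])
    fix a b assume "a \<in> Field r" "b \<in> Field r"
    then obtain c where c: "(a, c) \<in> r" "(b, c) \<in> r" using assms by (auto simp: directed_def)
    then have "{d. (c, d) \<in> r} \<subseteq> {d. (a, d) \<in> r} \<inter> {d. (b, d) \<in> r}"
      using tr by (auto dest: transD)
    moreover have "c \<in> Field r" using c by (auto simp: Field_def)
    ultimately show "\<exists>x\<in>Field r. principal {b. (x, b) \<in> r}
        \<le> inf (principal {b. (a, b) \<in> r}) (principal {c. (b, c) \<in> r})"
      by (intro bexI[of _ c]) (auto simp: inf_principal)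
  qed
  then show ?thesis by (simp add: eventually_principal)
qed

definition decreases_to_zero :: "'j rel \<Rightarrow> ('j \<Rightarrow> 'a::archimedean_vector_lattice) \<Rightarrow> bool" where
  "decreases_to_zero s y \<longleftrightarrow>
     directed s \<and> (\<forall>(a, b)\<in>s. y b \<le> y a) \<and> isGlb UNIV (y ` Field s) 0"

text \<open>The dominating net may have an arbitrary index set. Since a definition cannot quantify over
  types, its index set is taken inside \<open>'a\<close>; by \<open>order_convI\<close> below, this is no restriction.\<close>

definition order_conv :: "'i rel \<Rightarrow> ('i \<Rightarrow> 'a::archimedean_vector_lattice) \<Rightarrow> 'a \<Rightarrow> bool" where
  "order_conv r x l \<longleftrightarrow>
     (\<exists>(s::'a rel) y. decreases_to_zero s y \<and>
        (\<forall>b\<in>Field s. \<exists>a\<in>Field r. \<forall>a'. (a, a') \<in> r \<longrightarrow> \<bar>l - x a'\<bar> \<le> y b))"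

definition uo_conv :: "'i rel \<Rightarrow> ('i \<Rightarrow> 'a::archimedean_vector_lattice) \<Rightarrow> 'a \<Rightarrow> bool" where
  "uo_conv r x l \<longleftrightarrow> (\<forall>y\<ge>0. order_conv r (\<lambda>a. inf \<bar>x a - l\<bar> y) 0)"

lemma order_convI:
  fixes s :: "'j rel" and x :: "'i \<Rightarrow> 'a::archimedean_vector_lattice"
  assumes s: "decreases_to_zero s y"
    and dom: "\<And>b. b \<in> Field s \<Longrightarrow> \<exists>a\<in>Field r. \<forall>a'. (a, a') \<in> r \<longrightarrow> \<bar>l - x a'\<bar> \<le> y b"
  shows "order_conv r x l"
proof -
  define Y where "Y = y ` Field s"
  define s' where "s' = {(u, v). u \<in> Y \<and> v \<in> Y \<and> v \<le> u}"
  have F: "Field s' = Y" by (auto simp: s'_def Field_def)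
  have ds: "directed s" and dec: "\<And>a b. (a, b) \<in> s \<Longrightarrow> y b \<le> y a"
    using s by (auto simp: decreases_to_zero_def)
  have dir: "\<exists>w. (u, w) \<in> s' \<and> (v, w) \<in> s'" if uv: "u \<in> Y" "v \<in> Y" for u v
  proof -
    obtain a b where ab: "a \<in> Field s" "b \<in> Field s" "u = y a" "v = y b"
      using uv unfolding Y_def by blast
    obtain c where c: "(a, c) \<in> s" "(b, c) \<in> s" using ds ab by (auto simp: directed_def)
    then have "y c \<in> Y" by (auto simp: Y_def Field_def)
    then have "(u, y c) \<in> s'" "(v, y c) \<in> s'" using ab c dec uv by (auto simp: s'_def)
    then show ?thesis by blast
  qed
  have "Preorder s'"
    unfolding preorder_on_def F by (auto simp: s'_def refl_on_def trans_def)
  then have "directed s'"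
    using ds dir unfolding directed_def F by (auto simp: Y_def)
  moreover have "isGlb UNIV ((\<lambda>u. u) ` Field s') 0"
    using s unfolding F by (simp add: Y_def decreases_to_zero_def)
  ultimately have "decreases_to_zero s' (\<lambda>u. u)"
    by (auto simp: decreases_to_zero_def s'_def)
  then show ?thesis
    unfolding order_conv_def using dom F by (intro exI[of _ s'] exI[of _ "\<lambda>u. u"]) (auto simp: Y_def)
qed

text \<open>Quantification over all nets in \<open>'a\<close> is rendered by quantification over the nets whose
  index set lies in \<open>'a set \<times> 'a\<close>. This is no restriction: an arbitrary net \<open>x\<close> has the same
  order limits, unbounded order limits and topological limits as the net \<open>snd\<close> on the set of pairs
  of a tail of \<open>x\<close> and a member of that tail, and the two nets have the same values.\<close>

definition canon_index :: "'i rel \<Rightarrow> ('i \<Rightarrow> 'a) \<Rightarrow> ('a set \<times> 'a) set" where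
  "canon_index r x = {(x ` {c. (a, c) \<in> r}, x b) | a b. (a, b) \<in> r}"

definition canon :: "'i rel \<Rightarrow> ('i \<Rightarrow> 'a) \<Rightarrow> ('a set \<times> 'a) rel" where
  "canon r x = {(p, q). p \<in> canon_index r x \<and> q \<in> canon_index r x \<and> fst q \<subseteq> fst p}"

lemma Field_canon: "Field (canon r x) = canon_index r x"
  by (auto simp: canon_def Field_def)

lemma canon_indexI: "(a, b) \<in> r \<Longrightarrow> (x ` {c. (a, c) \<in> r}, x b) \<in> canon_index r x"
  unfolding canon_index_def by blast

lemma canon_indexE:
  assumes "p \<in> canon_index r x"
  obtains a b where "p = (x ` {c. (a, c) \<in> r}, x b)" "(a, b) \<in> r"
  using assms unfolding canon_index_def by blast

lemma directed_canon:
  assumes "directed r"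
  shows "directed (canon r x)"
proof -
  have tr: "trans r" and re: "\<And>a. a \<in> Field r \<Longrightarrow> (a, a) \<in> r" and ne: "Field r \<noteq> {}"
    using assms by (auto simp: directed_def preorder_on_def refl_on_def)
  have "Preorder (canon r x)"
    unfolding preorder_on_def Field_canon by (auto simp: canon_def refl_on_def trans_def)
  moreover have "Field (canon r x) \<noteq> {}" using ne re canon_indexI[where r=r and x=x] unfolding Field_canon by blast
  moreover have "\<exists>c. (p, c) \<in> canon r x \<and> (q, c) \<in> canon r x"
    if pq: "p \<in> Field (canon r x)" "q \<in> Field (canon r x)" for p q
  proof -
    obtain a b where p: "p = (x ` {c. (a, c) \<in> r}, x b)" "(a, b) \<in> r"
      using pq unfolding Field_canon by (blast elim: canon_indexE)
    obtain a' b' where q: "q = (x ` {c. (a', c) \<in> r}, x b')" "(a', b') \<in> r"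
      using pq unfolding Field_canon by (blast elim: canon_indexE)
    have "a \<in> Field r" "a' \<in> Field r" using p q by (auto simp: Field_def)
    then obtain c where c: "(a, c) \<in> r" "(a', c) \<in> r" using assms by (auto simp: directed_def)
    have "c \<in> Field r" using c by (auto simp: Field_def)
    then have cc: "(c, c) \<in> r" by (rule re)
    let ?m = "(x ` {d. (c, d) \<in> r}, x c)"
    have "?m \<in> Field (canon r x)" using cc unfolding Field_canon by (rule canon_indexI)
    moreover have "fst ?m \<subseteq> fst p" "fst ?m \<subseteq> fst q"
      using c tr unfolding p q by (auto dest: transD)
    ultimately have "(p, ?m) \<in> canon r x \<and> (q, ?m) \<in> canon r x"
      using pq unfolding Field_canon by (simp add: canon_def)
    then show ?thesis by blast
  qed
  ultimately show ?thesis by (simp add: directed_def)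
qed

lemma ex_tail_canon:
  assumes "directed r"
  shows "(\<exists>p\<in>Field (canon r x). \<forall>q. (p, q) \<in> canon r x \<longrightarrow> P (snd q)) \<longleftrightarrow>
         (\<exists>a\<in>Field r. \<forall>b. (a, b) \<in> r \<longrightarrow> P (x b))"
proof
  assume "\<exists>p\<in>Field (canon r x). \<forall>q. (p, q) \<in> canon r x \<longrightarrow> P (snd q)"
  then obtain p where p: "p \<in> Field (canon r x)" "\<And>q. (p, q) \<in> canon r x \<Longrightarrow> P (snd q)" by blast
  obtain a b where ab: "p = (x ` {c. (a, c) \<in> r}, x b)" "(a, b) \<in> r"
    using p(1) unfolding Field_canon by (rule canon_indexE)
  have "P (x c)" if "(a, c) \<in> r" for c
  proof -
    have "(x ` {c. (a, c) \<in> r}, x c) \<in> Field (canon r x)" using that unfolding Field_canon by (rule canon_indexI)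
    then have "(p, (x ` {c. (a, c) \<in> r}, x c)) \<in> canon r x"
      using p(1) unfolding Field_canon ab(1) by (simp add: canon_def)
    then show ?thesis using p(2) by fastforce
  qed
  then show "\<exists>a\<in>Field r. \<forall>b. (a, b) \<in> r \<longrightarrow> P (x b)" using ab by (auto simp: Field_def)
next
  assume "\<exists>a\<in>Field r. \<forall>b. (a, b) \<in> r \<longrightarrow> P (x b)"
  then obtain a where a: "a \<in> Field r" "\<And>b. (a, b) \<in> r \<Longrightarrow> P (x b)" by blast
  have aa: "(a, a) \<in> r" using assms a(1) by (auto simp: directed_def preorder_on_def refl_on_def)
  let ?p = "(x ` {c. (a, c) \<in> r}, x a)"
  have "?p \<in> Field (canon r x)" using aa unfolding Field_canon by (rule canon_indexI)
  moreover have "P (snd q)" if q: "(?p, q) \<in> canon r x" for q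
  proof -
    have *: "q \<in> canon_index r x" "fst q \<subseteq> x ` {c. (a, c) \<in> r}"
      using q unfolding canon_def by auto
    obtain d e where q': "q = (x ` {c. (d, c) \<in> r}, x e)" "(d, e) \<in> r"
      using *(1) by (rule canon_indexE)
    then have "x e \<in> x ` {c. (a, c) \<in> r}" using *(2) by auto
    then show ?thesis using a(2) unfolding q'(1) by auto
  qed
  ultimately show "\<exists>p\<in>Field (canon r x). \<forall>q. (p, q) \<in> canon r x \<longrightarrow> P (snd q)" by blast
qed

lemma values_canon:
  assumes "directed r"
  shows "snd ` Field (canon r x) = x ` Field r"
proof -
  have "x a \<in> snd ` canon_index r x" if "a \<in> Field r" for a
  proof -
    have "(a, a) \<in> r" using assms that by (auto simp: directed_def preorder_on_def refl_on_def)
    from canon_indexI[OF this, of x] show ?thesis by (rule rev_image_eqI) simp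
  qed
  moreover have "snd p \<in> x ` Field r" if "p \<in> canon_index r x" for p
    using that by (rule canon_indexE) (auto simp: Field_def)
  ultimately show ?thesis unfolding Field_canon by blast
qed

lemma order_conv_canon:
  assumes "directed r"
  shows "order_conv (canon r x) (\<lambda>p. f (snd p)) l \<longleftrightarrow> order_conv r (\<lambda>a. f (x a)) l"
proof -
  have "(\<exists>p\<in>Field (canon r x). \<forall>q. (p, q) \<in> canon r x \<longrightarrow> \<bar>l - f (snd q)\<bar> \<le> z) \<longleftrightarrow>
        (\<exists>a\<in>Field r. \<forall>b. (a, b) \<in> r \<longrightarrow> \<bar>l - f (x b)\<bar> \<le> z)" for z
    using ex_tail_canon[OF assms, where x=x and P="\<lambda>v. \<bar>l - f v\<bar> \<le> z"] .
  then show ?thesis unfolding order_conv_def by (simp only:)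
qed

lemma uo_conv_canon:
  assumes "directed r"
  shows "uo_conv (canon r x) snd l \<longleftrightarrow> uo_conv r x l"
proof -
  have "order_conv (canon r x) (\<lambda>p. inf \<bar>snd p - l\<bar> y) 0 \<longleftrightarrow>
        order_conv r (\<lambda>a. inf \<bar>x a - l\<bar> y) 0" for y
    using order_conv_canon[OF assms, where x=x and f="\<lambda>v. inf \<bar>v - l\<bar> y"] .
  then show ?thesis by (simp only: uo_conv_def)
qed

lemma limitin_canon:
  assumes "directed r"
  shows "limitin T snd l (tails (canon r x)) \<longleftrightarrow> limitin T x l (tails r)"
proof -
  have "eventually (\<lambda>p. snd p \<in> U) (tails (canon r x)) \<longleftrightarrow> eventually (\<lambda>a. x a \<in> U) (tails r)" for U
    unfolding eventually_tails[OF assms] eventually_tails[OF directed_canon[OF assms]]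
    using ex_tail_canon[OF assms, where x=x and P="\<lambda>v. v \<in> U"] .
  then show ?thesis by (simp only: limitin_def)
qed

definition o_adherence :: "'a::archimedean_vector_lattice set \<Rightarrow> 'a set" where
  "o_adherence S =
     {l. \<exists>(r::('a set \<times> 'a) rel) x. directed r \<and> x ` Field r \<subseteq> S \<and> order_conv r x l}"

definition uo_adherence :: "'a::archimedean_vector_lattice set \<Rightarrow> 'a set" where
  "uo_adherence S =
     {l. \<exists>(r::('a set \<times> 'a) rel) x. directed r \<and> x ` Field r \<subseteq> S \<and> uo_conv r x l}"

definition seq_o_adherence :: "'a::archimedean_vector_lattice set \<Rightarrow> 'a set" where
  "seq_o_adherence S =
     {l. \<exists>x::nat \<Rightarrow> 'a. range x \<subseteq> S \<and> order_conv {(m, n). m \<le> n} x l}"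

definition seq_uo_adherence :: "'a::archimedean_vector_lattice set \<Rightarrow> 'a set" where
  "seq_uo_adherence S =
     {l. \<exists>x::nat \<Rightarrow> 'a. range x \<subseteq> S \<and> uo_conv {(m, n). m \<le> n} x l}"

lemma o_adherenceI:
  fixes r :: "'i rel"
  assumes "directed r" "x ` Field r \<subseteq> S" "order_conv r x l"
  shows "l \<in> o_adherence S"
proof -
  have "order_conv (canon r x) snd l"
    using order_conv_canon[OF assms(1), of x "\<lambda>v. v"] assms(3) by simp
  then show ?thesis
    unfolding o_adherence_def
    using directed_canon[OF assms(1), of x] values_canon[OF assms(1), of x] assms(2) by blast
qed

lemma uo_adherenceI:
  fixes r :: "'i rel"
  assumes "directed r" "x ` Field r \<subseteq> S" "uo_conv r x l"
  shows "l \<in> uo_adherence S"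
  unfolding uo_adherence_def
  using directed_canon[OF assms(1), of x] values_canon[OF assms(1), of x] assms(2)
    uo_conv_canon[OF assms(1), of x l] assms(3) by blast

definition linear_topology :: "'a::real_vector topology \<Rightarrow> bool" where
  "linear_topology T \<longleftrightarrow> topspace T = UNIV \<and>
     continuous_map (prod_topology T T) T (\<lambda>(x, y). x + y) \<and>
     continuous_map (prod_topology euclideanreal T) T (\<lambda>(c, x). c *\<^sub>R x)"

definition locally_solid :: "'a::archimedean_vector_lattice topology \<Rightarrow> bool" where
  "locally_solid T \<longleftrightarrow> linear_topology T \<and>
     (\<forall>U. openin T U \<and> 0 \<in> U \<longrightarrow>
        (\<exists>V W. solid V \<and> V \<subseteq> U \<and> openin T W \<and> 0 \<in> W \<and> W \<subseteq> V))"

definition uo_Lebesgue :: "'a::archimedean_vector_lattice topology \<Rightarrow> bool" where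
  "uo_Lebesgue T \<longleftrightarrow> locally_solid T \<and>
     (\<forall>(r::('a set \<times> 'a) rel) x. directed r \<and> uo_conv r x 0 \<longrightarrow> limitin T x 0 (tails r))"

lemma uo_LebesgueD:
  fixes r :: "'i rel"
  assumes "uo_Lebesgue T" "directed r" "uo_conv r x 0"
  shows "limitin T x 0 (tails r)"
  using assms directed_canon[OF assms(2), of x] uo_conv_canon[OF assms(2), of x 0]
    limitin_canon[OF assms(2), where T=T and x=x and l=0]
  unfolding uo_Lebesgue_def by blast

end

theory Submission
  imports Defs
begin

text \<open>
  The inclusions
  \<open>seq_o_adherence F \<subseteq> o_adherence F \<subseteq> uo_adherence F \<subseteq> T closure_of F\<close> and
  \<open>seq_o_adherence F \<subseteq> seq_uo_adherence F \<subseteq> uo_adherence F\<close> hold for every set \<open>F\<close>: order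
  convergence implies unbounded order convergence, which implies convergence in \<open>T\<close>. The content of
  the theorem is therefore that every \<open>l\<close> in the closure of \<open>F\<close> is the order limit of a sequence
  in \<open>F\<close>.

  The topology need not be metrizable, but the countable sup property provides a countable family of
  neighbourhoods that is good enough. Consider sequences \<open>V\<close> of solid neighbourhoods of \<open>0\<close> with
  \<open>V (n + 1) + V (n + 1) \<subseteq> V n\<close>. The kernel \<open>\<Inter>n. V n\<close> is a topologically closed solid set that is
  closed under addition, and since the suprema of upward directed sets are topological limits, the
  positive elements of the kernel below a given \<open>e \<ge> 0\<close> have a greatest element \<open>p V\<close>. As \<open>T\<close> is
  Hausdorff, the infimum of all \<open>p V\<close> is \<open>0\<close>; hence already countably many of them have infimum
  \<open>0\<close>, and the kernel of a diagonal sequence that is finer than all of these contains no positive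
  element below \<open>e\<close> except \<open>0\<close>
  (\<open>ex_normal_seq_trivial_kernel\<close>).

  With such a \<open>V\<close>, every sequence \<open>x\<close> with \<open>0 \<le> x n \<le> e\<close> and \<open>x n \<in> V (n + 1)\<close> is order null,
  by the argument which shows that a sequence of measurable functions that tends to \<open>0\<close> in measure
  fast enough tends to \<open>0\<close> almost everywhere: the tail suprema \<open>SUP n\<in>{m + 1..}. x n\<close> belong to
  \<open>V m\<close>, so their infimum lies in the kernel (\<open>rapidly_null_imp_order_null\<close>).

  Finally, let \<open>l\<close> be in the closure of \<open>F\<close>, and let \<open>c *\<^sub>R e\<close> dominate \<open>\<bar>l\<bar>\<close>, where \<open>e \<in> F\<close> is a
  positive strong unit. Truncation at \<open>\<plusminus> c *\<^sub>R e\<close> does not leave \<open>F\<close> and does not increase the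
  distance to \<open>l\<close>, so there are \<open>f n \<in> F\<close> between \<open>- c *\<^sub>R e\<close> and \<open>c *\<^sub>R e\<close> with
  \<open>f n - l \<in> V (n + 1)\<close>. As \<open>\<bar>l - f n\<bar> \<le> (2 * c) *\<^sub>R e\<close>, the sequence \<open>f\<close> is order convergent to \<open>l\<close>
  if \<open>V\<close> was chosen for the bound \<open>(2 * c) *\<^sub>R e\<close>.
\<close>

section \<open>Order convergence, unbounded order convergence, and topological closure\<close>

lemma directed_nat: "directed {(m::nat, n). m \<le> n}"
proof -
  have F: "Field {(m::nat, n). m \<le> n} = UNIV" by (auto simp: Field_def)
  show ?thesis
    unfolding directed_def preorder_on_def F
    by (auto simp: refl_on_def trans_def intro: max.cobounded1 max.cobounded2)
qed

lemma order_conv_imp_uo_conv: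
  fixes x :: "'i \<Rightarrow> 'a::archimedean_vector_lattice"
  assumes "order_conv r x l"
  shows "uo_conv r x l"
  unfolding uo_conv_def
proof (intro allI impI)
  fix u :: 'a assume u: "0 \<le> u"
  obtain s :: "'a rel" and y where s: "decreases_to_zero s y"
    and dom: "\<forall>b\<in>Field s. \<exists>a\<in>Field r. \<forall>a'. (a, a') \<in> r \<longrightarrow> \<bar>l - x a'\<bar> \<le> y b"
    using assms unfolding order_conv_def by blast
  have "\<bar>0 - inf (\<bar>x a - l\<bar>) u\<bar> \<le> \<bar>l - x a\<bar>" for a
  proof -
    have "0 \<le> inf \<bar>x a - l\<bar> u" using u by simp
    then have "\<bar>0 - inf (\<bar>x a - l\<bar>) u\<bar> = inf (\<bar>x a - l\<bar>) u" by simp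
    also have "\<dots> \<le> \<bar>l - x a\<bar>" by (simp add: abs_minus_commute le_infI1)
    finally show ?thesis .
  qed
  with dom show "order_conv r (\<lambda>a. inf \<bar>x a - l\<bar> u) 0"
    by (intro order_convI[OF s]) (meson order_trans)
qed

lemma openin_translation:
  fixes T :: "'a::real_vector topology"
  assumes "linear_topology T" "openin T U"
  shows "openin T {y. y + z \<in> U}"
proof -
  have top: "topspace T = UNIV"
    and add: "continuous_map (prod_topology T T) T (\<lambda>(x, y). x + y)"
    using assms(1) by (auto simp: linear_topology_def)
  have "continuous_map T (prod_topology T T) (\<lambda>y. (y, z))"
    by (simp add: continuous_map_pairwise o_def top)
  from continuous_map_compose[OF this add]
  have "continuous_map T T (\<lambda>y. y + z)" by (simp add: o_def)
  from openin_continuous_map_preimage[OF this assms(2)] show ?thesis by (simp add: top)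
qed

lemma closure_meets_nhd:
  fixes T :: "'a::real_vector topology"
  assumes "linear_topology T" and z: "z \<in> T closure_of S" and W: "openin T W" "0 \<in> W"
  shows "\<exists>v\<in>S. v - z \<in> W"
proof -
  have "openin T {y. y + (- z) \<in> W}" using assms by (intro openin_translation)
  moreover have "z \<in> {y. y + (- z) \<in> W}" using W(2) by simp
  ultimately have "\<exists>v. v \<in> S \<and> v \<in> {y. y + (- z) \<in> W}"
    by (intro z[unfolded in_closure_of, THEN conjunct2, rule_format] conjI)
  then show ?thesis by auto
qed

lemma uo_limit_in_closure:
  assumes T: "uo_Lebesgue T" and r: "directed r" and sub: "x ` Field r \<subseteq> S"
    and conv: "uo_conv r x l"
  shows "l \<in> T closure_of S"
proof -
  have lin: "linear_topology T" using T by (simp add: uo_Lebesgue_def locally_solid_def)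
  have "uo_conv r (\<lambda>a. x a - l) 0" using conv by (simp add: uo_conv_def)
  then have lim: "limitin T (\<lambda>a. x a - l) 0 (tails r)" by (rule uo_LebesgueD[OF T r])
  have "\<exists>y\<in>S. y \<in> U" if U: "l \<in> U" "openin T U" for U
  proof -
    have "openin T {y. y + l \<in> U}" using openin_translation[OF lin U(2)] .
    then have "eventually (\<lambda>a. x a - l \<in> {y. y + l \<in> U}) (tails r)"
      using lim U(1) unfolding limitin_def by (metis add_0 mem_Collect_eq)
    then obtain a where a: "a \<in> Field r" "\<forall>b. (a, b) \<in> r \<longrightarrow> x b \<in> U"
      unfolding eventually_tails[OF r] by auto
    have "(a, a) \<in> r" using r a(1) by (auto simp: directed_def preorder_on_def refl_on_def)
    then show ?thesis using a sub by blast
  qed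
  then show ?thesis using lin by (auto simp: in_closure_of linear_topology_def)
qed

text \<open>Regarded as a net indexed by itself, an upward directed set is order convergent to its
  supremum.\<close>

lemma directed_Sup_in_closure:
  fixes A :: "'a::archimedean_vector_lattice set"
  assumes T: "uo_Lebesgue T" and ne: "A \<noteq> {}"
    and dir: "\<And>a b. a \<in> A \<Longrightarrow> b \<in> A \<Longrightarrow> \<exists>c\<in>A. a \<le> c \<and> b \<le> c"
    and lub: "isLub UNIV A s"
  shows "s \<in> T closure_of A"
proof -
  define r where "r = {(a, b). a \<in> A \<and> b \<in> A \<and> a \<le> b}"
  have F: "Field r = A" by (auto simp: r_def Field_def)
  have r: "directed r"
    unfolding directed_def preorder_on_def F using ne dir
    by (auto simp: r_def refl_on_def trans_def)
  have ub: "a \<le> s" if "a \<in> A" for a using lub that by (auto simp: isLub_def isUb_def leastP_def setle_def)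
  have least: "s \<le> u" if "\<And>a. a \<in> A \<Longrightarrow> a \<le> u" for u
    using lub that by (auto simp: isLub_def isUb_def leastP_def setle_def setge_def)
  have "isGlb UNIV ((\<lambda>a. s - a) ` A) 0"
  proof -
    have "u \<le> 0" if "\<And>a. a \<in> A \<Longrightarrow> u \<le> s - a" for u
    proof -
      have "s \<le> s - u" using that by (intro least) (simp add: algebra_simps)
      then show ?thesis by simp
    qed
    then show ?thesis
      using ub by (auto simp: isGlb_def isLb_def greatestP_def setle_def setge_def)
  qed
  then have "decreases_to_zero r (\<lambda>a. s - a)"
    using r unfolding decreases_to_zero_def F by (auto simp: r_def)
  moreover have "\<forall>a'. (a, a') \<in> r \<longrightarrow> \<bar>s - a'\<bar> \<le> s - a" for a
    using ub by (auto simp: r_def)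
  ultimately have "order_conv r (\<lambda>a. a) s" by (intro order_convI) blast+
  then show ?thesis
    using uo_limit_in_closure[OF T r] order_conv_imp_uo_conv F by fastforce
qed

section \<open>Normal sequences of solid neighbourhoods\<close>

definition solid_nhd :: "'a::archimedean_vector_lattice topology \<Rightarrow> 'a set \<Rightarrow> bool" where
  "solid_nhd T V \<longleftrightarrow> solid V \<and> (\<exists>W. openin T W \<and> 0 \<in> W \<and> W \<subseteq> V)"

definition normal_seq :: "'a::archimedean_vector_lattice topology \<Rightarrow> (nat \<Rightarrow> 'a set) \<Rightarrow> bool" where
  "normal_seq T V \<longleftrightarrow>
     (\<forall>n. solid_nhd T (V n) \<and> (\<forall>x\<in>V (Suc n). \<forall>y\<in>V (Suc n). x + y \<in> V n))"

lemma solidD: "solid S \<Longrightarrow> y \<in> S \<Longrightarrow> \<bar>x\<bar> \<le> \<bar>y\<bar> \<Longrightarrow> x \<in> S"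
  by (auto simp: solid_def)

lemma normal_seqD:
  assumes "normal_seq T V"
  shows "solid (V n)" "solid_nhd T (V n)" "0 \<in> V n"
    "x \<in> V (Suc n) \<Longrightarrow> y \<in> V (Suc n) \<Longrightarrow> x + y \<in> V n"
  using assms by (auto simp: normal_seq_def solid_nhd_def)

lemma normal_seq_antimono:
  assumes "normal_seq T V" "m \<le> n"
  shows "V n \<subseteq> V m"
  using assms(2)
proof (rule lift_Suc_antimono_le[rotated])
  show "V (Suc k) \<subseteq> V k" for k
    using normal_seqD(3,4)[OF assms(1)] by (metis add.right_neutral subsetI)
qed

lemma solid_nhd_halve:
  assumes T: "locally_solid T" and V: "solid_nhd T V"
  shows "\<exists>V'. solid_nhd T V' \<and> (\<forall>x\<in>V'. \<forall>y\<in>V'. x + y \<in> V)"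
proof -
  obtain W where W: "openin T W" "0 \<in> W" "W \<subseteq> V" using V by (auto simp: solid_nhd_def)
  have top: "topspace T = UNIV"
    and add: "continuous_map (prod_topology T T) T (\<lambda>(x, y). x + y)"
    using T by (auto simp: locally_solid_def linear_topology_def)
  have "openin (prod_topology T T) {p. fst p + snd p \<in> W}"
    using openin_continuous_map_preimage[OF add W(1)] by (simp add: top case_prod_unfold)
  moreover have "(0, 0) \<in> {p. fst p + snd p \<in> W}" using W(2) by simp
  ultimately have "\<exists>A B. openin T A \<and> openin T B \<and> 0 \<in> A \<and> 0 \<in> B \<and>
      A \<times> B \<subseteq> {p. fst p + snd p \<in> W}"
    by (rule openin_prod_topology_alt[THEN iffD1, rule_format])
  then obtain A B where AB: "openin T A" "openin T B" "0 \<in> A" "0 \<in> B"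
    "A \<times> B \<subseteq> {p. fst p + snd p \<in> W}"
    by (elim exE conjE)
  then have "openin T (A \<inter> B)" "0 \<in> A \<inter> B" by auto
  then obtain V' where V': "solid_nhd T V'" "V' \<subseteq> A \<inter> B"
    using T unfolding locally_solid_def solid_nhd_def by (metis (no_types, lifting))
  then show ?thesis using AB(5) W(3) by fastforce
qed

lemma ex_normal_seq_from:
  assumes T: "locally_solid T" and U: "solid_nhd T U"
  shows "\<exists>V. normal_seq T V \<and> V 0 = U"
proof -
  have "\<exists>V. \<forall>n. (solid_nhd T (V n) \<and> (n = 0 \<longrightarrow> V n = U)) \<and>
      (\<forall>x\<in>V (Suc n). \<forall>y\<in>V (Suc n). x + y \<in> V n)"
    by (rule dependent_nat_choice) (use U solid_nhd_halve[OF T] in auto)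
  then show ?thesis unfolding normal_seq_def by blast
qed

lemma closure_normal_seq:
  assumes T: "locally_solid T" and V: "normal_seq T V"
  shows "T closure_of V (Suc n) \<subseteq> V n"
proof
  fix z assume z: "z \<in> T closure_of V (Suc n)"
  obtain W where W: "openin T W" "0 \<in> W" "W \<subseteq> V (Suc n)"
    using normal_seqD(2)[OF V] by (auto simp: solid_nhd_def)
  have "linear_topology T" using T by (simp add: locally_solid_def)
  then obtain v where v: "v \<in> V (Suc n)" "v - z \<in> W"
    using closure_meets_nhd[OF _ z W(1,2)] by blast
  have "z - v \<in> V (Suc n)"
  proof (rule solidD)
    show "v - z \<in> V (Suc n)" using v(2) W(3) by blast
    show "\<bar>z - v\<bar> \<le> \<bar>v - z\<bar>" by (simp add: abs_minus_commute)
  qed (rule normal_seqD(1)[OF V])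
  with v(1) have "v + (z - v) \<in> V n" by (rule normal_seqD(4)[OF V])
  then show "z \<in> V n" by simp
qed

lemma sup_le_add_nonneg:
  fixes a b :: "'a::lattice_ab_group_add"
  assumes "0 \<le> a" "0 \<le> b"
  shows "sup a b \<le> a + b"
  using assms by simp

text \<open>The positive elements of the kernel below \<open>e\<close> form an upward directed set, and the kernel is
  topologically closed; so their supremum, which exists by Dedekind completeness, is one of them.\<close>

lemma kernel_has_greatest_below:
  fixes T :: "'a::{archimedean_vector_lattice, conditionally_complete_lattice} topology"
  assumes T: "uo_Lebesgue T" and V: "normal_seq T V" and e: "0 \<le> e"
  shows "\<exists>p. 0 \<le> p \<and> p \<le> e \<and> p \<in> (\<Inter>n. V n) \<and>
             (\<forall>x. 0 \<le> x \<and> x \<le> e \<and> x \<in> (\<Inter>n. V n) \<longrightarrow> x \<le> p)"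
proof -
  have ls: "locally_solid T" using T by (simp add: uo_Lebesgue_def)
  define A where "A = {x. 0 \<le> x \<and> x \<le> e \<and> x \<in> (\<Inter>n. V n)}"
  have zero: "0 \<in> A" using e normal_seqD(3)[OF V] by (simp add: A_def)
  have bdd: "bdd_above A" by (rule bdd_aboveI[of _ e]) (simp add: A_def)
  have lub: "isLub UNIV A (Sup A)" using zero bdd by (intro isLub_cSup) (auto simp: setle_def bdd_above_def)
  have dir: "\<exists>c\<in>A. a \<le> c \<and> b \<le> c" if ab: "a \<in> A" "b \<in> A" for a b
  proof -
    have pos: "0 \<le> a" "0 \<le> b" using ab by (auto simp: A_def)
    have le: "\<bar>sup a b\<bar> \<le> \<bar>a + b\<bar>"
      using sup_le_add_nonneg[OF pos] pos by (simp add: le_supI1)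
    have "sup a b \<in> V n" for n
    proof -
      have "a + b \<in> V n" using ab by (intro normal_seqD(4)[OF V]) (auto simp: A_def)
      then show ?thesis using normal_seqD(1)[OF V] le by (blast intro: solidD)
    qed
    then have "sup a b \<in> A" using ab by (auto simp: A_def intro: le_supI1)
    then show ?thesis by (intro bexI[of _ "sup a b"]) auto
  qed
  have "Sup A \<in> T closure_of A"
    using T zero dir lub by (intro directed_Sup_in_closure) auto
  moreover have "T closure_of A \<subseteq> V n" for n
  proof -
    have "T closure_of A \<subseteq> T closure_of V (Suc n)" by (rule closure_of_mono) (auto simp: A_def)
    then show ?thesis using closure_normal_seq[OF ls V] by blast
  qed
  ultimately have "Sup A \<in> (\<Inter>n. V n)" by blast
  moreover have "0 \<le> Sup A" using zero bdd by (rule cSup_upper)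
  moreover have "Sup A \<le> e" using zero by (intro cSup_least) (auto simp: A_def)
  moreover have "x \<le> Sup A" if "0 \<le> x \<and> x \<le> e \<and> x \<in> (\<Inter>n. V n)" for x
    using that bdd by (intro cSup_upper) (auto simp: A_def)
  ultimately show ?thesis by blast
qed

text \<open>The intersections \<open>\<Inter>k\<le>n. W k n\<close> of the diagonal blocks are finite, hence still neighbourhoods,
  and for \<open>n\<close> large they are contained in any given \<open>W k m\<close>.\<close>

lemma normal_seq_diagonal:
  fixes W :: "nat \<Rightarrow> nat \<Rightarrow> 'a::archimedean_vector_lattice set"
  assumes W: "\<And>k. normal_seq T (W k)"
  shows "\<exists>V. normal_seq T V \<and> (\<forall>k. (\<Inter>n. V n) \<subseteq> (\<Inter>n. W k n))"
proof -
  define V where "V n = (\<Inter>k\<le>n. W k n)" for n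
  have "solid_nhd T (V n)" for n
  proof -
    have "\<forall>k. \<exists>U. openin T U \<and> 0 \<in> U \<and> U \<subseteq> W k n"
      using normal_seqD(2)[OF W] unfolding solid_nhd_def by blast
    from choice[OF this] obtain G where G: "\<And>k. openin T (G k) \<and> 0 \<in> G k \<and> G k \<subseteq> W k n"
      by blast
    have "solid (V n)" using normal_seqD(1)[OF W] unfolding V_def solid_def by blast
    moreover have "openin T (\<Inter>k\<le>n. G k)" using G by (intro openin_Inter) auto
    moreover have "0 \<in> (\<Inter>k\<le>n. G k)" "(\<Inter>k\<le>n. G k) \<subseteq> V n" using G by (auto simp: V_def)
    ultimately show ?thesis unfolding solid_nhd_def by blast
  qed
  moreover have "x + y \<in> V n" if "x \<in> V (Suc n)" "y \<in> V (Suc n)" for x y n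
    using that normal_seqD(4)[OF W] by (auto simp: V_def)
  ultimately have "normal_seq T V" by (simp add: normal_seq_def)
  moreover have "(\<Inter>n. V n) \<subseteq> W k m" for k m
  proof -
    have "V (max k m) \<subseteq> W k (max k m)" by (auto simp: V_def)
    also have "\<dots> \<subseteq> W k m" by (rule normal_seq_antimono[OF W]) simp
    finally show ?thesis by blast
  qed
  ultimately show ?thesis by blast
qed

text \<open>Every neighbourhood contains the kernel of some normal sequence, so in a Hausdorff topology the
  greatest kernel elements \<open>p V\<close> have infimum \<open>0\<close>. The countable sup property, applied to the
  elements \<open>e - p V\<close>, selects countably many \<open>V\<close>; the kernel of their diagonal sequence is
  contained in all of theirs.\<close>

lemma ex_normal_seq_trivial_kernel:
  fixes T :: "'a::{archimedean_vector_lattice, conditionally_complete_lattice} topology"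
  assumes csp: "countable_sup_property TYPE('a)"
    and T: "uo_Lebesgue T" and haus: "Hausdorff_space T" and e: "0 \<le> e"
  shows "\<exists>V. normal_seq T V \<and> (\<forall>x. 0 \<le> x \<and> x \<le> e \<and> x \<in> (\<Inter>n. V n) \<longrightarrow> x = 0)"
proof -
  have ls: "locally_solid T" using T by (simp add: uo_Lebesgue_def)
  then have top: "topspace T = UNIV" by (simp add: locally_solid_def linear_topology_def)
  obtain p where p: "\<And>V. normal_seq T V \<Longrightarrow> 0 \<le> p V \<and> p V \<le> e \<and> p V \<in> (\<Inter>n. V n) \<and>
             (\<forall>x. 0 \<le> x \<and> x \<le> e \<and> x \<in> (\<Inter>n. V n) \<longrightarrow> x \<le> p V)"
    using kernel_has_greatest_below[OF T _ e] by metis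
  define S where "S = (\<lambda>V. e - p V) ` Collect (normal_seq T)"
  have "solid_nhd T UNIV"
    unfolding solid_nhd_def using openin_topspace[of T] top by (auto simp: solid_def)
  then obtain V0 where V0: "normal_seq T V0" using ex_normal_seq_from[OF ls] by blast
  have sep: "x = 0" if x: "\<And>V. normal_seq T V \<Longrightarrow> x \<in> V 0" for x
  proof (rule ccontr)
    assume "x \<noteq> 0"
    then obtain U where U: "openin T U" "0 \<in> U" "x \<notin> U"
      using haus top unfolding Hausdorff_space_def disjnt_def by (metis UNIV_I disjoint_iff)
    then obtain V' where V': "solid_nhd T V'" "V' \<subseteq> U"
      using ls unfolding locally_solid_def solid_nhd_def by (metis (no_types, lifting))
    from ex_normal_seq_from[OF ls V'(1)] x V'(2) U(3) show False by blast
  qed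
  have "isLub UNIV S e"
  proof -
    have "e \<le> u" if u: "\<And>V. normal_seq T V \<Longrightarrow> e - p V \<le> u" for u
    proof -
      have "sup (e - u) 0 \<in> V 0" if V: "normal_seq T V" for V
      proof (rule solidD)
        show "p V \<in> V 0" using p[OF V] by blast
        have "sup (e - u) 0 \<le> p V" using u[OF V] p[OF V] by (simp add: algebra_simps)
        then show "\<bar>sup (e - u) 0\<bar> \<le> \<bar>p V\<bar>" using p[OF V] by simp
      qed (rule normal_seqD(1)[OF V])
      then have "sup (e - u) 0 = 0" by (rule sep)
      then have "e - u \<le> 0" by (metis sup.cobounded1)
      then show ?thesis by simp
    qed
    then show ?thesis
      using p by (auto simp: S_def isLub_def isUb_def leastP_def setle_def setge_def)
  qed
  moreover have "S \<noteq> {}" using V0 by (auto simp: S_def)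
  ultimately obtain C where C: "C \<subseteq> S" "countable C" "isLub UNIV C e"
    using csp unfolding countable_sup_property_def by blast
  then obtain \<V> where \<V>: "countable \<V>" "\<V> \<subseteq> Collect (normal_seq T)" "C = (\<lambda>V. e - p V) ` \<V>"
    unfolding S_def by (metis countable_subset_image)
  \<comment> \<open>The countable family may be empty (if \<open>e = 0\<close>); inserting \<open>V0\<close> makes it enumerable.\<close>
  define W where "W = from_nat_into (insert V0 \<V>)"
  have ran: "range W = insert V0 \<V>" unfolding W_def using \<V>(1) by (simp add: range_from_nat_into)
  have W: "normal_seq T (W k)" for k
  proof -
    have "W k \<in> insert V0 \<V>" unfolding ran[symmetric] by (rule rangeI)
    then show ?thesis using \<V>(2) V0 by auto
  qed
  obtain V where V: "normal_seq T V" "\<forall>k. (\<Inter>n. V n) \<subseteq> (\<Inter>n. W k n)"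
    using normal_seq_diagonal[of T W, OF W] by (elim exE conjE)
  have "x = 0" if x: "0 \<le> x" "x \<le> e" "x \<in> (\<Inter>n. V n)" for x
  proof -
    have "x \<le> p (W k)" for k
    proof -
      have "x \<in> (\<Inter>n. W k n)" using V(2)[rule_format, of k] x(3) by (rule subsetD)
      then show ?thesis using p[OF W] x(1,2) by blast
    qed
    then have "x \<le> p V'" if "V' \<in> \<V>" for V' using that ran by (metis imageE insertCI)
    then have "\<And>c. c \<in> C \<Longrightarrow> c \<le> e - x" unfolding \<V>(3) by auto
    then have "e \<le> e - x"
      using C(3) by (auto simp: isLub_def isUb_def leastP_def setle_def setge_def)
    then show ?thesis using x(1) by simp
  qed
  then show ?thesis using V(1) by blast
qed

section \<open>Order null sequences\<close>

lemma normal_seq_sum: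
  assumes V: "normal_seq T V" and x: "\<And>n. x n \<in> V (Suc n)"
  shows "(\<Sum>n=m..<m+k. x n) \<in> V m"
proof (induction k arbitrary: m)
  case 0
  then show ?case using normal_seqD(3)[OF V] by simp
next
  case (Suc k)
  have "(\<Sum>n=m..<m+Suc k. x n) = x m + (\<Sum>n=Suc m..<Suc m+k. x n)"
    by (simp add: sum.atLeast_Suc_lessThan)
  then show ?case using normal_seqD(4)[OF V x Suc.IH] by simp
qed

text \<open>Finite suprema of positive elements are dominated by sums, and the sums of a tail stay in
  \<open>V m\<close> because consecutive terms lie in halved neighbourhoods. The full supremum of a tail is a
  directed supremum of elements below such sums, so it remains in the closure of \<open>V m\<close>.\<close>

lemma tail_Sup_in_normal_seq:
  fixes T :: "'a::{archimedean_vector_lattice, conditionally_complete_lattice} topology"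
  assumes T: "uo_Lebesgue T" and V: "normal_seq T V"
    and x: "\<And>n. x n \<in> V (Suc n)" and pos: "\<And>n. 0 \<le> x n" and bd: "\<And>n. x n \<le> e"
  shows "(SUP n\<in>{Suc m..}. x n) \<in> V m"
proof -
  have ls: "locally_solid T" using T by (simp add: uo_Lebesgue_def)
  define s where "s = (SUP n\<in>{Suc m..}. x n)"
  define \<sigma> where "\<sigma> k = (\<Sum>n=Suc m..<Suc m+k. x n)" for k
  define A where "A = {a. 0 \<le> a \<and> a \<le> s \<and> (\<exists>k. a \<le> \<sigma> k)}"
  have bdd: "bdd_above (x ` {Suc m..})" using bd by (rule bdd_aboveI2)
  have xs: "x n \<le> s" if "Suc m \<le> n" for n unfolding s_def using bdd that by (intro cSUP_upper) auto
  have mono: "\<sigma> k \<le> \<sigma> k'" if "k \<le> k'" for k k'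
    unfolding \<sigma>_def using that pos by (intro sum_mono2) auto
  have xA: "x n \<in> A" if n: "Suc m \<le> n" for n
  proof -
    have "x n = sum x {n}" by simp
    also have "\<dots> \<le> \<sigma> (n - m)" unfolding \<sigma>_def using n pos by (intro sum_mono2) auto
    finally show ?thesis using pos xs[OF n] by (auto simp: A_def)
  qed
  have lub: "isLub UNIV A s"
  proof -
    have "s \<le> u" if "\<And>a. a \<in> A \<Longrightarrow> a \<le> u" for u
      unfolding s_def using that xA by (intro cSUP_least) auto
    then show ?thesis by (auto simp: A_def isLub_def isUb_def leastP_def setle_def setge_def)
  qed
  have dir: "\<exists>c\<in>A. a \<le> c \<and> b \<le> c" if ab: "a \<in> A" "b \<in> A" for a b
  proof -
    obtain k k' where "a \<le> \<sigma> k" "b \<le> \<sigma> k'" using ab by (auto simp: A_def)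
    then have "a \<le> \<sigma> (max k k')" "b \<le> \<sigma> (max k k')"
      by (meson mono max.cobounded1 max.cobounded2 order_trans)+
    then have "sup a b \<le> \<sigma> (max k k')" by simp
    then have "sup a b \<in> A" using ab by (auto simp: A_def intro: le_supI1)
    then show ?thesis by (intro bexI[of _ "sup a b"]) auto
  qed
  have "A \<subseteq> V (Suc m)"
  proof
    fix a assume a: "a \<in> A"
    then obtain k where k: "0 \<le> a" "a \<le> \<sigma> k" by (auto simp: A_def)
    have "\<sigma> k \<in> V (Suc m)" unfolding \<sigma>_def using V x by (rule normal_seq_sum)
    moreover have "\<bar>a\<bar> \<le> \<bar>\<sigma> k\<bar>" using k by (metis abs_of_nonneg order_trans)
    ultimately show "a \<in> V (Suc m)" using normal_seqD(1)[OF V] by (blast intro: solidD)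
  qed
  moreover have "s \<in> T closure_of A"
    using T xA[of "Suc m"] dir lub by (intro directed_Sup_in_closure) auto
  ultimately have "s \<in> T closure_of V (Suc m)" using closure_of_mono by blast
  then show ?thesis using closure_normal_seq[OF ls V] by (auto simp: s_def)
qed

lemma rapidly_null_imp_order_null:
  fixes T :: "'a::{archimedean_vector_lattice, conditionally_complete_lattice} topology"
  assumes T: "uo_Lebesgue T" and V: "normal_seq T V"
    and ker: "\<And>z. 0 \<le> z \<Longrightarrow> z \<le> e \<Longrightarrow> z \<in> (\<Inter>n. V n) \<Longrightarrow> z = 0"
    and x: "\<And>n. \<bar>l - x n\<bar> \<in> V (Suc n)" and bd: "\<And>n. \<bar>l - x n\<bar> \<le> e"
  shows "order_conv {(m, n). m \<le> n} x l"
proof -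
  define s where "s m = (SUP n\<in>{m..}. \<bar>l - x n\<bar>)" for m
  have bdd: "bdd_above ((\<lambda>n. \<bar>l - x n\<bar>) ` B)" for B using bd by (rule bdd_aboveI2)
  have xs: "\<bar>l - x n\<bar> \<le> s m" if "m \<le> n" for m n
    unfolding s_def using that by (intro cSUP_upper bdd) auto
  have pos: "0 \<le> s m" for m using xs[of m m] abs_ge_zero order_trans by blast
  have dec: "s n \<le> s m" if "m \<le> n" for m n
    unfolding s_def[of n] using that xs by (intro cSUP_least) auto
  have sV: "s (Suc m) \<in> V m" for m
    unfolding s_def using T V x abs_ge_zero bd by (rule tail_Sup_in_normal_seq)
  have F: "Field {(m::nat, n). m \<le> n} = UNIV" by (auto simp: Field_def)
  have "isGlb UNIV (range s) 0"
  proof -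
    have "u \<le> 0" if u: "\<And>m. u \<le> s m" for u
    proof -
      have le: "sup u 0 \<le> s m" for m using u pos by simp
      have "sup u 0 \<in> V m" for m
      proof (rule solidD)
        show "\<bar>sup u 0\<bar> \<le> \<bar>s (Suc m)\<bar>" using le pos by simp
      qed (use sV normal_seqD(1)[OF V] in auto)
      moreover have "s 0 \<le> e" unfolding s_def using bd by (intro cSUP_least) auto
      then have "sup u 0 \<le> e" using le order_trans by blast
      ultimately have "sup u 0 = 0" by (intro ker) auto
      then show ?thesis by (metis sup.cobounded1)
    qed
    then show ?thesis
      using pos by (auto simp: isGlb_def isLb_def greatestP_def setle_def setge_def)
  qed
  then have "decreases_to_zero {(m, n). m \<le> n} s"
    using directed_nat dec unfolding decreases_to_zero_def F by auto
  then show ?thesis by (rule order_convI) (use xs F in auto)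
qed

section \<open>Approximation from a sublattice\<close>

lemma truncation_closer:
  fixes f l u :: "'a::lattice_ab_group_add_abs"
  assumes "\<bar>l\<bar> \<le> u"
  shows "\<bar>sup (- u) (inf f u) - l\<bar> \<le> \<bar>f - l\<bar>"
proof -
  have l: "l \<le> u" "- u \<le> l" using assms by (auto simp: abs_le_iff minus_le_iff)
  have "f \<le> l + \<bar>f - l\<bar>" using abs_ge_self[of "f - l"] by (simp add: algebra_simps)
  moreover have "- u \<le> l + \<bar>f - l\<bar>" using l(2) by (simp add: add_increasing2)
  ultimately have 1: "sup (- u) (inf f u) \<le> l + \<bar>f - l\<bar>" by (simp add: le_infI1)
  have "l - \<bar>f - l\<bar> \<le> f" using abs_ge_minus_self[of "f - l"] by (simp add: algebra_simps)
  moreover have "l - \<bar>f - l\<bar> \<le> u" using l(1) by (meson abs_ge_zero diff_left_mono diff_zero order_trans le_diff_eq add_increasing2 diff_le_eq)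
  ultimately have 2: "l - \<bar>f - l\<bar> \<le> sup (- u) (inf f u)" by (simp add: le_supI2)
  show ?thesis
  proof (rule abs_leI)
    show "sup (- u) (inf f u) - l \<le> \<bar>f - l\<bar>" using 1 by (simp only: diff_le_eq add.commute)
    show "- (sup (- u) (inf f u) - l) \<le> \<bar>f - l\<bar>"
      using 2 by (simp only: minus_diff_eq diff_le_eq add.commute)
  qed
qed

lemma closure_sublattice_subset_seq_o_adherence:
  fixes T :: "'a::{archimedean_vector_lattice, conditionally_complete_lattice} topology"
  assumes csp: "countable_sup_property TYPE('a)"
    and T: "uo_Lebesgue T" and haus: "Hausdorff_space T"
    and F: "vector_sublattice F" and unit: "e \<in> F" "strong_order_unit e"
  shows "T closure_of F \<subseteq> seq_o_adherence F"
proof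
  fix l assume l: "l \<in> T closure_of F"
  have sub: "subspace F" and lat: "\<And>x y. x \<in> F \<Longrightarrow> y \<in> F \<Longrightarrow> sup x y \<in> F \<and> inf x y \<in> F"
    using F by (auto simp: vector_sublattice_def)
  obtain c where c: "0 \<le> c" "\<bar>l\<bar> \<le> c *\<^sub>R \<bar>e\<bar>" using unit(2) by (auto simp: strong_order_unit_def)
  define u where "u = c *\<^sub>R \<bar>e\<bar>"
  have lu: "\<bar>l\<bar> \<le> u" using c(2) by (simp add: u_def)
  then have u0: "0 \<le> u" using abs_ge_zero order_trans by blast
  have "\<bar>e\<bar> \<in> F" unfolding abs_lattice using lat unit(1) subspace_neg[OF sub] by blast
  then have uF: "u \<in> F" "- u \<in> F"
    unfolding u_def using subspace_scale[OF sub] subspace_neg[OF sub] by blast+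
  \<comment> \<open>The distance of two elements between \<open>- u\<close> and \<open>u\<close> is at most \<open>u + u\<close>.\<close>
  have "0 \<le> u + u" using u0 by simp
  then obtain V where V: "normal_seq T V"
    and ker: "\<And>x. 0 \<le> x \<Longrightarrow> x \<le> u + u \<Longrightarrow> x \<in> (\<Inter>n. V n) \<Longrightarrow> x = 0"
    using ex_normal_seq_trivial_kernel[OF csp T haus] by metis
  have "\<exists>f\<in>F. \<bar>l - f\<bar> \<in> V (Suc n) \<and> \<bar>l - f\<bar> \<le> u + u" for n
  proof -
    have lin: "linear_topology T" using T by (simp add: uo_Lebesgue_def locally_solid_def)
    obtain W where W: "openin T W" "0 \<in> W" "W \<subseteq> V (Suc n)"
      using normal_seqD(2)[OF V] by (auto simp: solid_nhd_def)
    obtain g where g: "g \<in> F" "g - l \<in> W" using closure_meets_nhd[OF lin l W(1,2)] by blast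
    define f where "f = sup (- u) (inf g u)"
    have "f \<in> F" unfolding f_def using lat g(1) uF by blast
    moreover have "\<bar>l - f\<bar> \<in> V (Suc n)"
    proof (rule solidD)
      show "g - l \<in> V (Suc n)" using g(2) W(3) by blast
      show "\<bar>\<bar>l - f\<bar>\<bar> \<le> \<bar>g - l\<bar>"
        using truncation_closer[OF lu, of g] by (simp add: f_def abs_minus_commute)
    qed (rule normal_seqD(1)[OF V])
    moreover have "\<bar>l - f\<bar> \<le> u + u"
    proof -
      have "- u \<le> u" using u0 by (meson neg_le_0_iff_le order_trans)
      then have "\<bar>f\<bar> \<le> u" unfolding f_def by (auto simp: abs_le_iff minus_le_iff)
      then show ?thesis using abs_triangle_ineq4[of l f] lu add_mono order_trans by blast
    qed
    ultimately show ?thesis by blast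
  qed
  then obtain f where f: "\<And>n. f n \<in> F" "\<And>n. \<bar>l - f n\<bar> \<in> V (Suc n)" "\<And>n. \<bar>l - f n\<bar> \<le> u + u"
    by metis
  have "order_conv {(m, n). m \<le> n} f l"
    using T V ker f(2,3) by (rule rapidly_null_imp_order_null)
  then show "l \<in> seq_o_adherence F" using f(1) by (auto simp: seq_o_adherence_def)
qed

theorem theorem6p12:
  fixes T :: "'a::{archimedean_vector_lattice, conditionally_complete_lattice} topology"
    and F :: "'a set"
  assumes "countable_sup_property TYPE('a)"
    and "\<exists>e::'a. strong_order_unit e"
    and "uo_Lebesgue T" and "Hausdorff_space T"
    and "vector_sublattice F"
    and "\<exists>e\<in>F. strong_order_unit e"
  shows "T closure_of F = seq_o_adherence F \<and>
         seq_o_adherence F = o_adherence F \<and>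
         o_adherence F = seq_uo_adherence F \<and>
         seq_uo_adherence F = uo_adherence F"
proof -
  obtain e where "e \<in> F" "strong_order_unit e" using assms(6) by blast
  with assms(1,3,4,5) have "T closure_of F \<subseteq> seq_o_adherence F"
    by (rule closure_sublattice_subset_seq_o_adherence)
  moreover have "seq_o_adherence F \<subseteq> o_adherence F"
  proof
    fix l assume "l \<in> seq_o_adherence F"
    then obtain x where x: "range x \<subseteq> F" "order_conv {(m::nat, n). m \<le> n} x l"
      unfolding seq_o_adherence_def by blast
    then have "x ` Field {(m::nat, n). m \<le> n} \<subseteq> F" by blast
    with directed_nat show "l \<in> o_adherence F" using x(2) by (rule o_adherenceI)
  qed
  moreover have "seq_o_adherence F \<subseteq> seq_uo_adherence F"
    unfolding seq_o_adherence_def seq_uo_adherence_def by (blast intro: order_conv_imp_uo_conv)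
  moreover have "o_adherence F \<subseteq> uo_adherence F"
    unfolding o_adherence_def uo_adherence_def by (blast intro: order_conv_imp_uo_conv)
  moreover have "seq_uo_adherence F \<subseteq> uo_adherence F"
  proof
    fix l assume "l \<in> seq_uo_adherence F"
    then obtain x where x: "range x \<subseteq> F" "uo_conv {(m::nat, n). m \<le> n} x l"
      unfolding seq_uo_adherence_def by blast
    then have "x ` Field {(m::nat, n). m \<le> n} \<subseteq> F" by blast
    with directed_nat show "l \<in> uo_adherence F" using x(2) by (rule uo_adherenceI)
  qed
  moreover have "uo_adherence F \<subseteq> T closure_of F"
    unfolding uo_adherence_def by (blast intro: uo_limit_in_closure[OF assms(3)])
  ultimately show ?thesis by blast
qed

end
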